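(* As formal power series in $x$ with coefficients in $\mathbb{Q}[s,t]$, $$P^{(\mathsf{pk},\mathsf{dbl})}(s,t;x)=\frac{\frac{\partial}{\partial x}V(s,t;x)}{1-sV(s,t;x)}.$$
   Context: Let $\mathfrak{S}_n$ be the set of permutations $\pi=\pi_1\cdots\pi_n$ (one-line notation) of $[n]=\{1,\dots,n\}$. Use the convention $\pi_0=\pi_{n+1}=\infty$. A letter $\pi_i$ ($1\le i\le n$) of $\pi$ is a peak if $\pi_{i-1}<\pi_i>\pi_{i+1}$ (so necessarily $2\le i\le n-1$), a double ascent if $\pi_{i-1}<\pi_i<\pi_{i+1}$, and a double descent if $\pi_{i-1}>\pi_i>\pi_{i+1}$. Let $\mathsf{pk}(\pi)$ be the number of peaks of $\pi$ and $\mathsf{dbl}(\pi)$ the total number of double ascents and double descents of $\pi$. Define $$P^{(\mathsf{pk},\mathsf{dbl})}(s,t;x)=\sum_{n=1}^\infty\Big(\sum_{\pi\in\mathfrak{S}_n}s^{\mathsf{pk}(\pi)}t^{\mathsf{dbl}(\pi)}\Big)\frac{x^n}{n!}.$$ The bivariate Chebyshev polynomials of the second kind are defined by $U_0(s,t)=1$, $U_1(s,t)=2t$, and $U_n(s,t)=2tU_{n-1}(s,t)-sU_{n-2}(s,t)$ for $n\ge2$. Define $V(s,t;x)=\sum_{n=0}^\infty U_n(s,t)\frac{x^{n+2}}{(n+2)!}$. *)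

theory Defs
  imports
    "HOL-Library.Extended_Nat"
    "HOL-Combinatorics.Multiset_Permutations"
    "HOL-Computational_Algebra.Polynomial"
    "HOL-Computational_Algebra.Formal_Power_Series"
begin

(* A permutation of {1..n} is its one-line word, an element of permutations_of_set {1..n}. *)

(* letter w i is the i-th letter, counted from 1, with letter w 0 = letter w (length w + 1) = \<infinity>. *)
definition letter :: "nat list \<Rightarrow> nat \<Rightarrow> enat" where
  "letter w i = (if 1 \<le> i \<and> i \<le> length w then enat (w ! (i - 1)) else \<infinity>)"

definition is_peak :: "nat list \<Rightarrow> nat \<Rightarrow> bool" where
  "is_peak w i \<longleftrightarrow> letter w (i - 1) < letter w i \<and> letter w i > letter w (i + 1)"

definition is_double_ascent :: "nat list \<Rightarrow> nat \<Rightarrow> bool" where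
  "is_double_ascent w i \<longleftrightarrow> letter w (i - 1) < letter w i \<and> letter w i < letter w (i + 1)"

definition is_double_descent :: "nat list \<Rightarrow> nat \<Rightarrow> bool" where
  "is_double_descent w i \<longleftrightarrow> letter w (i - 1) > letter w i \<and> letter w i > letter w (i + 1)"

definition pk :: "nat list \<Rightarrow> nat" where
  "pk w = card {i \<in> {1..length w}. is_peak w i}"

definition dbl :: "nat list \<Rightarrow> nat" where
  "dbl w = card {i \<in> {1..length w}. is_double_ascent w i}
         + card {i \<in> {1..length w}. is_double_descent w i}"

(* Q[s,t] is represented as Q[s][t]: s is the inner and t the outer indeterminate. *)
type_synonym coeff_ring = "rat poly poly"

definition var_s :: coeff_ring where
  "var_s = [:[:0, 1:]:]"

definition var_t :: coeff_ring where
  "var_t = [:0, 1:]"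

definition P_pk_dbl :: "coeff_ring fps" where
  "P_pk_dbl = Abs_fps (\<lambda>n. if n = 0 then 0 else
     smult [:1 / fact n:]
       (\<Sum>w \<in> permutations_of_set {1..n}. var_s ^ pk w * var_t ^ dbl w))"

fun cheb_U :: "'a::comm_ring_1 \<Rightarrow> 'a \<Rightarrow> nat \<Rightarrow> 'a" where
  "cheb_U s t 0 = 1"
| "cheb_U s t (Suc 0) = 2 * t"
| "cheb_U s t (Suc (Suc n)) = 2 * t * cheb_U s t (Suc n) - s * cheb_U s t n"

definition V :: "coeff_ring fps" where
  "V = Abs_fps (\<lambda>n. if n < 2 then 0 else smult [:1 / fact n:] (cheb_U var_s var_t (n - 2)))"

(* The operator / on fps needs an inverse on the coefficients, which Q[s,t] does not have.
   Division by a series with constant coefficient 1 is therefore expressed by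
   fps_right_inverse, whose second argument is the inverse of the constant coefficient. *)
definition fps_quot :: "'a::comm_ring_1 fps \<Rightarrow> 'a fps \<Rightarrow> 'a fps" where
  "fps_quot f g = f * fps_right_inverse g 1"

lemma fps_quot_eq_iff:
  assumes "fps_nth g 0 = 1"
  shows "h = fps_quot f g \<longleftrightarrow> h * g = f"
proof -
  have inv: "g * fps_right_inverse g 1 = 1"
    by (rule fps_right_inverse) (simp add: assms)
  show ?thesis
  proof
    assume "h = fps_quot f g"
    then have "h * g = f * (g * fps_right_inverse g 1)"
      by (simp only: fps_quot_def ac_simps)
    then show "h * g = f"
      by (simp only: inv mult_1_right)
  next
    assume "h * g = f"
    then have "fps_quot f g = h * (g * fps_right_inverse g 1)"
      by (simp only: fps_quot_def ac_simps flip: \<open>h * g = f\<close>)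
    then show "h = fps_quot f g"
      by (simp only: inv mult_1_right)
  qed
qed

lemma V_denominator_nth_0: "fps_nth (1 - fps_const var_s * V) 0 = 1"
  by (simp add: V_def)

end

theory Submission
  imports Defs
begin

text \<open>
  Both letters adjacent to the maximum of a word are smaller than it, so for the factors on either
  side of the maximum it plays the role of the boundary letter \<open>\<infinity>\<close>. Splitting a permutation at its
  maximum therefore yields the Riccati equation \<open>P' = 1 + 2tP + sP\<^sup>2\<close>, while the Chebyshev recurrence
  says \<open>V'' = 1 + 2tV' - sV\<close>. Consequently \<open>W = P(1 - sV) - V'\<close> solves the linear equation
  \<open>W' = (2t + sP)W\<close> with \<open>W(0) = 0\<close>, which forces \<open>W = 0\<close>.
\<close>

section \<open>Splitting a word at its maximum\<close>

text \<open>Serves to count positions in \<open>u @ m # v\<close> with \<open>k = length u\<close>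
  and \<open>l = length v\<close>. The last block is shifted back by \<open>Suc k\<close> so that it
  runs over the positions of \<open>v\<close> itself.\<close>

lemma card_Suc_split_at:
  "card {i \<in> {1..k + Suc l}. Q i} =
     card {i \<in> {1..k}. Q i} + (if Q (Suc k) then 1 else 0) + card {i \<in> {1..l}. Q (Suc k + i)}"
proof -
  have "{i \<in> {1..k + Suc l}. Q i} =
      {i \<in> {1..k}. Q i} \<union> {i \<in> {Suc k}. Q i} \<union> (\<lambda>i. Suc k + i) ` {i \<in> {1..l}. Q (Suc k + i)}"
    (is "_ = ?A \<union> ?B \<union> ?C")
  proof (intro equalityI subsetI)
    fix i assume i: "i \<in> {i \<in> {1..k + Suc l}. Q i}"
    consider "i \<le> k" | "i = Suc k" | "Suc k < i" by linarith
    then show "i \<in> ?A \<union> ?B \<union> ?C"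
    proof cases
      case 3
      then have "i = Suc k + (i - Suc k)" "i - Suc k \<in> {1..l}" using i by auto
      then have "i \<in> ?C" using i by (metis (mono_tags, lifting) image_eqI mem_Collect_eq)
      then show ?thesis by blast
    qed (use i in auto)
  qed auto
  moreover have "card (?A \<union> ?B \<union> ?C) = card (?A \<union> ?B) + card ?C"
    by (rule card_Un_disjoint) auto
  moreover have "card (?A \<union> ?B) = card ?A + card ?B"
    by (rule card_Un_disjoint) auto
  moreover have "card ?C = card {i \<in> {1..l}. Q (Suc k + i)}"
    by (rule card_image) (auto simp: inj_on_def)
  moreover have "card ?B = (if Q (Suc k) then 1 else 0)"
    by (cases "Q (Suc k)") (auto simp: Collect_conv_if)
  ultimately show ?thesis by simp
qed

context
  fixes u v :: "nat list" and m :: nat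
  assumes less_m: "\<forall>x \<in> set u \<union> set v. x < m"
begin

text \<open>The boundary index 0 is included, as both letters are \<infinity> there. The bound on
  \<open>i\<close> is sharp: one position further, \<open>u\<close> has \<infinity> and the whole
  word has \<open>m\<close>.\<close>

lemma letter_split_left:
  assumes "i \<le> length u"
  shows "letter (u @ m # v) i = letter u i"
  using assms by (auto simp: letter_def nth_append)

lemma letter_split_max: "letter (u @ m # v) (Suc (length u)) = enat m"
  by (simp add: letter_def)

lemma letter_split_right:
  assumes "0 < i"
  shows "letter (u @ m # v) (Suc (length u) + i) = letter v i"
  using assms by (auto simp: letter_def nth_append nth_Cons')

lemma letter_left_less:
  assumes "i \<in> {1..length u}"
  shows "letter u i < enat m"
  using assms less_m by (auto simp: letter_def)

lemma letter_right_less: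
  assumes "i \<in> {1..length v}"
  shows "letter v i < enat m"
  using assms less_m by (auto simp: letter_def)

text \<open>The right neighbours differ only at \<open>i = length u\<close>, where one is
  \<open>m\<close> and the other \<infinity>. Both exceed the letter at \<open>i\<close>, so the
  comparisons come out the same.\<close>

lemma less_letter_split_left_iff:
  assumes "i \<in> {1..length u}"
  shows "letter (u @ m # v) (i + 1) < letter u i \<longleftrightarrow> letter u (i + 1) < letter u i"
    and "letter u i < letter (u @ m # v) (i + 1) \<longleftrightarrow> letter u i < letter u (i + 1)"
proof -
  have "i = length u \<or> i + 1 \<le> length u" using assms by auto
  moreover have "letter u (length u + 1) = \<infinity>" by (simp add: letter_def)
  moreover have "letter u i < \<infinity>" using assms by (simp add: letter_def)
  ultimately show "letter (u @ m # v) (i + 1) < letter u i \<longleftrightarrow> letter u (i + 1) < letter u i"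
    and "letter u i < letter (u @ m # v) (i + 1) \<longleftrightarrow> letter u i < letter u (i + 1)"
    using letter_left_less[OF assms] letter_split_left[of "i + 1"] letter_split_max
    by (auto simp: not_less less_imp_le)
qed

text \<open>Mirror image: the left neighbours differ only at \<open>i = 1\<close>, where
  \<open>m\<close> replaces \<infinity>.\<close>

lemma less_letter_split_right_iff:
  assumes "i \<in> {1..length v}"
  shows "letter (u @ m # v) (length u + i) < letter v i \<longleftrightarrow> letter v (i - 1) < letter v i"
    and "letter v i < letter (u @ m # v) (length u + i) \<longleftrightarrow> letter v i < letter v (i - 1)"
proof -
  have "i = 1 \<or> 0 < i - 1 \<and> length u + i = Suc (length u) + (i - 1)" using assms by auto
  moreover have "letter v 0 = \<infinity>" by (simp add: letter_def)
  moreover have "letter v i < \<infinity>" using assms by (simp add: letter_def)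
  ultimately show "letter (u @ m # v) (length u + i) < letter v i \<longleftrightarrow> letter v (i - 1) < letter v i"
    and "letter v i < letter (u @ m # v) (length u + i) \<longleftrightarrow> letter v i < letter v (i - 1)"
    using letter_right_less[OF assms] letter_split_right[of "i - 1"] letter_split_max
    by (auto simp: not_less less_imp_le)
qed

section \<open>Peaks, double ascents and double descents across the split\<close>

lemmas pattern_defs = is_peak_def is_double_ascent_def is_double_descent_def

lemma pattern_split_left:
  assumes "i \<in> {1..length u}"
  shows "is_peak (u @ m # v) i = is_peak u i"
    and "is_double_ascent (u @ m # v) i = is_double_ascent u i"
    and "is_double_descent (u @ m # v) i = is_double_descent u i"
  unfolding pattern_defs
  using assms letter_split_left[of i] letter_split_left[of "i - 1"] less_letter_split_left_iff[OF assms]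
  by auto

lemma pattern_split_right:
  assumes "i \<in> {1..length v}"
  shows "is_peak (u @ m # v) (Suc (length u) + i) = is_peak v i"
    and "is_double_ascent (u @ m # v) (Suc (length u) + i) = is_double_ascent v i"
    and "is_double_descent (u @ m # v) (Suc (length u) + i) = is_double_descent v i"
  unfolding pattern_defs
  using assms letter_split_right[of i] letter_split_right[of "i + 1"]
    less_letter_split_right_iff[OF assms]
  by auto

text \<open>For empty \<open>u\<close> the position \<open>length u\<close> is 0, whose letter is
  \<infinity>; otherwise it holds the last letter of \<open>u\<close>.\<close>

lemma letter_before_max: "letter (u @ m # v) (length u) < enat m \<longleftrightarrow> u \<noteq> []"
  "enat m < letter (u @ m # v) (length u) \<longleftrightarrow> u = []"
  using letter_split_left[of "length u"] letter_left_less[of "length u"]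
  by (cases u; auto simp: letter_def)+

lemma letter_after_max: "letter (u @ m # v) (Suc (Suc (length u))) < enat m \<longleftrightarrow> v \<noteq> []"
  "enat m < letter (u @ m # v) (Suc (Suc (length u))) \<longleftrightarrow> v = []"
  using letter_split_right[of 1] letter_right_less[of 1]
  by (cases v; auto simp: letter_def)+

text \<open>If both factors are empty, the maximum is the whole word, lies between two infinite
  letters, and counts for neither statistic.\<close>

lemma pattern_split_max:
  "is_peak (u @ m # v) (Suc (length u)) \<longleftrightarrow> u \<noteq> [] \<and> v \<noteq> []"
  "is_double_ascent (u @ m # v) (Suc (length u)) \<longleftrightarrow> u \<noteq> [] \<and> v = []"
  "is_double_descent (u @ m # v) (Suc (length u)) \<longleftrightarrow> u = [] \<and> v \<noteq> []"
  by (simp_all add: pattern_defs letter_split_max letter_before_max letter_after_max)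

lemma pk_split_max:
  "pk (u @ m # v) = pk u + pk v + (if u \<noteq> [] \<and> v \<noteq> [] then 1 else 0)"
proof -
  have "pk (u @ m # v) = card {i \<in> {1..length u + Suc (length v)}. is_peak (u @ m # v) i}"
    by (simp add: pk_def)
  also have "\<dots> = card {i \<in> {1..length u}. is_peak u i} + (if u \<noteq> [] \<and> v \<noteq> [] then 1 else 0) +
      card {i \<in> {1..length v}. is_peak v i}"
    unfolding card_Suc_split_at pattern_split_max
    by (simp only: pattern_split_left pattern_split_right cong: conj_cong)
  finally show ?thesis by (simp add: pk_def)
qed

lemma dbl_split_max:
  "dbl (u @ m # v) = dbl u + dbl v + (if u = [] \<longleftrightarrow> v = [] then 0 else 1)"
proof -
  have "dbl (u @ m # v) =
      card {i \<in> {1..length u + Suc (length v)}. is_double_ascent (u @ m # v) i} +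
      card {i \<in> {1..length u + Suc (length v)}. is_double_descent (u @ m # v) i}"
    by (simp add: dbl_def)
  also have "\<dots> =
      card {i \<in> {1..length u}. is_double_ascent u i} + (if u \<noteq> [] \<and> v = [] then 1 else 0) +
      card {i \<in> {1..length v}. is_double_ascent v i} +
      (card {i \<in> {1..length u}. is_double_descent u i} + (if u = [] \<and> v \<noteq> [] then 1 else 0) +
      card {i \<in> {1..length v}. is_double_descent v i})"
    unfolding card_Suc_split_at pattern_split_max
    by (simp only: pattern_split_left pattern_split_right cong: conj_cong)
  finally show ?thesis by (auto simp: dbl_def)
qed

end

section \<open>The recurrence for the weighted sum over permutations\<close>

text \<open>Cutting at \<open>m\<close> is a bijection: a word is determined by the set
  \<open>B\<close> of letters to the left of \<open>m\<close> and the arrangements of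
  \<open>B\<close> and of \<open>A - B\<close>.\<close>

lemma sum_permutations_of_set_insert:
  assumes "finite A" "m \<notin> A"
  shows "(\<Sum>w \<in> permutations_of_set (insert m A). f w) =
    (\<Sum>B \<in> Pow A. \<Sum>u \<in> permutations_of_set B. \<Sum>v \<in> permutations_of_set (A - B). f (u @ m # v))"
proof -
  have "(\<Sum>B \<in> Pow A. \<Sum>u \<in> permutations_of_set B. \<Sum>v \<in> permutations_of_set (A - B). f (u @ m # v)) =
    (\<Sum>(B, u, v) \<in> (SIGMA B:Pow A. permutations_of_set B \<times> permutations_of_set (A - B)). f (u @ m # v))"
    using assms(1) by (simp add: sum.cartesian_product sum.Sigma case_prod_unfold)
  also have "\<dots> = (\<Sum>w \<in> permutations_of_set (insert m A). f w)"
  \<comment> \<open>The letter \<open>m\<close> occurs exactly once, so the prefix before its first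
    occurrence recovers \<open>u\<close>; \<open>tl\<close> then discards \<open>m\<close> to leave
    \<open>v\<close>.\<close>
  proof (rule sum.reindex_bij_witness[where
      i = "\<lambda>w. (set (takeWhile (\<lambda>x. x \<noteq> m) w), takeWhile (\<lambda>x. x \<noteq> m) w, tl (dropWhile (\<lambda>x. x \<noteq> m) w))"
      and j = "\<lambda>(B, u, v). u @ m # v"])
    fix w assume w: "w \<in> permutations_of_set (insert m A)"
    then obtain u v where uv: "w = u @ m # v"
      by (metis insertI1 permutations_of_setD(1) split_list)
    with w have uv_dist: "m \<notin> set u" "m \<notin> set v" "distinct u" "distinct v" "set u \<inter> set v = {}"
      "insert m (set u \<union> set v) = insert m A"
      by (auto simp: permutations_of_set_def)
    moreover have "set u \<union> set v = A"
      using uv_dist assms(2) by (subst (asm) insert_ident) auto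
    then have "set u \<subseteq> A" "set v = A - set u"
      using uv_dist(5) by auto
    moreover have "takeWhile (\<lambda>x. x \<noteq> m) w = u" "tl (dropWhile (\<lambda>x. x \<noteq> m) w) = v"
      using \<open>m \<notin> set u\<close> by (auto simp: uv takeWhile_append dropWhile_append)
    ultimately show "(set (takeWhile (\<lambda>x. x \<noteq> m) w), takeWhile (\<lambda>x. x \<noteq> m) w,
        tl (dropWhile (\<lambda>x. x \<noteq> m) w))
      \<in> (SIGMA B:Pow A. permutations_of_set B \<times> permutations_of_set (A - B))"
      and "(case (set (takeWhile (\<lambda>x. x \<noteq> m) w), takeWhile (\<lambda>x. x \<noteq> m) w,
        tl (dropWhile (\<lambda>x. x \<noteq> m) w)) of (B, u, v) \<Rightarrow> u @ m # v) = w"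
      by (simp_all add: uv permutations_of_set_def)
  next
    fix x assume "x \<in> (SIGMA B:Pow A. permutations_of_set B \<times> permutations_of_set (A - B))"
    then obtain B u v where x: "x = (B, u, v)" and B: "B \<subseteq> A"
      and u: "set u = B" "distinct u" and v: "set v = A - B" "distinct v"
      by (auto simp: permutations_of_set_def)
    have m: "m \<notin> set u" using assms(2) B u by auto
    show "(set (takeWhile (\<lambda>x. x \<noteq> m) (case x of (B, u, v) \<Rightarrow> u @ m # v)),
        takeWhile (\<lambda>x. x \<noteq> m) (case x of (B, u, v) \<Rightarrow> u @ m # v),
        tl (dropWhile (\<lambda>x. x \<noteq> m) (case x of (B, u, v) \<Rightarrow> u @ m # v))) = x"
      using m u by (auto simp: x takeWhile_append dropWhile_append)
    show "(case x of (B, u, v) \<Rightarrow> u @ m # v) \<in> permutations_of_set (insert m A)"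
      using assms(2) B u v by (auto simp: x permutations_of_set_def)
    show "f (case x of (B, u, v) \<Rightarrow> u @ m # v) = (case x of (B, u, v) \<Rightarrow> f (u @ m # v))"
      by (simp add: x)
  qed
  finally show ?thesis ..
qed

lemma sum_Pow_card:
  fixes g :: "nat \<Rightarrow> 'b::comm_semiring_1"
  assumes "finite A"
  shows "(\<Sum>B \<in> Pow A. g (card B)) = (\<Sum>k\<le>card A. of_nat (card A choose k) * g k)"
proof -
  have "(\<Sum>k\<le>card A. of_nat (card A choose k) * g k) =
      (\<Sum>k\<le>card A. \<Sum>B | B \<in> Pow A \<and> card B = k. g (card B))"
    using assms by (simp add: n_subsets)
  also have "\<dots> = (\<Sum>B \<in> Pow A. g (card B))"
    using assms by (intro sum.group) (auto simp: card_mono)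
  finally show ?thesis ..
qed

text \<open>The factor due to the maximum itself when \<open>k\<close> letters precede it and
  \<open>l\<close> follow it: \<open>s\<close> for a peak, \<open>t\<close> for a double ascent or
  descent, 1 for a one-letter word.\<close>

definition split_weight :: "'a::comm_ring_1 \<Rightarrow> 'a \<Rightarrow> nat \<Rightarrow> nat \<Rightarrow> 'a" where
  "split_weight s t k l =
     (if k \<noteq> 0 \<and> l \<noteq> 0 then s else if k = 0 \<and> l = 0 then 1 else t)"

text \<open>The value 1 at 0 is the weight of the empty word, which may occur as a factor. The
  binomial coefficient chooses which of the \<open>n\<close> smaller letters precede the
  maximum.\<close>

fun pk_dbl_poly :: "'a::comm_ring_1 \<Rightarrow> 'a \<Rightarrow> nat \<Rightarrow> 'a" where
  "pk_dbl_poly s t 0 = 1"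
| "pk_dbl_poly s t (Suc n) =
     (\<Sum>k\<le>n. of_nat (n choose k) *
       (split_weight s t k (n - k) * pk_dbl_poly s t k * pk_dbl_poly s t (n - k)))"

lemma weight_split_max:
  fixes s t :: "'a::comm_ring_1"
  assumes "\<forall>x \<in> set u \<union> set v. x < m"
  shows "s ^ pk (u @ m # v) * t ^ dbl (u @ m # v) =
    split_weight s t (length u) (length v) * (s ^ pk u * t ^ dbl u) * (s ^ pk v * t ^ dbl v)"
  by (simp add: pk_split_max[OF assms] dbl_split_max[OF assms] split_weight_def power_add)

text \<open>Stated for arbitrary finite sets because the two factors use subsets of the letters that
  need not be intervals; this makes induction on the cardinality applicable.\<close>

lemma sum_weight_eq_pk_dbl_poly:
  fixes s t :: "'a::comm_ring_1"
  assumes "finite A"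
  shows "(\<Sum>w \<in> permutations_of_set A. s ^ pk w * t ^ dbl w) = pk_dbl_poly s t (card A)"
  using assms
proof (induction "card A" arbitrary: A rule: less_induct)
  case (less A)
  show ?case
  proof (cases "A = {}")
    case True
    then show ?thesis by (simp add: pk_def dbl_def)
  next
    case False
    define m A' where "m = Max A" and "A' = A - {m}"
    have A: "A = insert m A'" "m \<notin> A'" "finite A'"
      using less.prems Max_in[OF less.prems False] by (auto simp: m_def A'_def)
    have lt: "x < m" if "x \<in> A'" for x
      using that less.prems by (auto simp: m_def A'_def less_le)
    have card: "card A = Suc (card A')" using A by simp
    have inner: "(\<Sum>u \<in> permutations_of_set B. \<Sum>v \<in> permutations_of_set (A' - B).
        s ^ pk (u @ m # v) * t ^ dbl (u @ m # v)) =
      split_weight s t (card B) (card A' - card B) *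
        pk_dbl_poly s t (card B) * pk_dbl_poly s t (card A' - card B)" if "B \<in> Pow A'" for B
    proof -
      have B: "finite B" "card (A' - B) = card A' - card B" "card B \<le> card A'"
        using that A(3) by (auto simp: card_Diff_subset finite_subset card_mono)
      have "(\<Sum>u \<in> permutations_of_set B. \<Sum>v \<in> permutations_of_set (A' - B).
          s ^ pk (u @ m # v) * t ^ dbl (u @ m # v)) =
        (\<Sum>u \<in> permutations_of_set B. \<Sum>v \<in> permutations_of_set (A' - B).
          split_weight s t (card B) (card A' - card B) * (s ^ pk u * t ^ dbl u) * (s ^ pk v * t ^ dbl v))"
      proof (intro sum.cong refl)
        fix u v assume u: "u \<in> permutations_of_set B" and v: "v \<in> permutations_of_set (A' - B)"
        have "\<forall>x \<in> set u \<union> set v. x < m"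
          using u v \<open>B \<in> Pow A'\<close> lt by (auto dest!: permutations_of_setD(1))
        from weight_split_max[OF this, of s t]
        show "s ^ pk (u @ m # v) * t ^ dbl (u @ m # v) =
            split_weight s t (card B) (card A' - card B) * (s ^ pk u * t ^ dbl u) * (s ^ pk v * t ^ dbl v)"
          using length_finite_permutations_of_set[OF u] length_finite_permutations_of_set[OF v] B(2)
          by simp
      qed
      also have "\<dots> = split_weight s t (card B) (card A' - card B) *
          (\<Sum>u \<in> permutations_of_set B. s ^ pk u * t ^ dbl u) *
          (\<Sum>v \<in> permutations_of_set (A' - B). s ^ pk v * t ^ dbl v)"
        by (simp only: sum_distrib_left sum_distrib_right) (rule sum.swap)
      also have "(\<Sum>u \<in> permutations_of_set B. s ^ pk u * t ^ dbl u) = pk_dbl_poly s t (card B)"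
        using B card by (intro less.hyps) auto
      also have "(\<Sum>v \<in> permutations_of_set (A' - B). s ^ pk v * t ^ dbl v) =
          pk_dbl_poly s t (card (A' - B))"
        using B card A(3) by (intro less.hyps) auto
      finally show ?thesis unfolding B(2) .
    qed
    have "(\<Sum>w \<in> permutations_of_set A. s ^ pk w * t ^ dbl w) =
      (\<Sum>B \<in> Pow A'. split_weight s t (card B) (card A' - card B) *
        pk_dbl_poly s t (card B) * pk_dbl_poly s t (card A' - card B))"
      unfolding A(1) sum_permutations_of_set_insert[OF A(3,2)] by (intro sum.cong refl inner)
    also have "\<dots> = pk_dbl_poly s t (card A)"
      unfolding card pk_dbl_poly.simps
      using sum_Pow_card[OF A(3), of "\<lambda>k. split_weight s t k (card A' - k) *
        pk_dbl_poly s t k * pk_dbl_poly s t (card A' - k)"] .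
    finally show ?thesis .
  qed
qed

section \<open>The differential equations\<close>

text \<open>Differentiation of an exponential generating function: the factor \<open>Suc n\<close>
  turns \<open>1 / fact (Suc n)\<close> into \<open>1 / fact n\<close>, so the coefficient sequence
  is merely shifted.\<close>

lemma of_nat_mult_smult_inverse_fact:
  "of_nat (Suc n) * smult [:1 / fact (Suc n):] p = smult [:1 / fact n:] (p :: rat poly poly)"
proof -
  have "of_nat (Suc n) * smult [:1 / fact (Suc n):] p =
      smult ([:of_nat (Suc n):] * [:1 / fact (Suc n):]) p"
    by (simp add: of_nat_poly del: of_nat_Suc)
  also have "[:of_nat (Suc n):] * [:1 / fact (Suc n):] = [:1 / fact n :: rat:]"
    by (simp add: field_simps del: of_nat_Suc)
  finally show ?thesis .
qed

text \<open>Turns the binomial convolution of coefficient sequences into the Cauchy product of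
  exponential generating functions.\<close>

lemma smult_inverse_fact_mult:
  assumes "k \<le> n"
  shows "smult [:1 / fact k:] p * smult [:1 / fact (n - k):] q =
    smult [:1 / fact n:] (of_nat (n choose k) * (p * q :: rat poly poly))"
proof -
  have "[:1 / fact k:] * [:1 / fact (n - k):] = [:1 / fact n:] * [:of_nat (n choose k) :: rat:]"
    using binomial_fact[OF assms, where 'a = rat] by (simp add: field_simps)
  then show ?thesis
    by (simp add: of_nat_poly mult.commute del: mult_pCons_left)
qed

lemma smult_sum_right: "smult c (\<Sum>i \<in> A. f i) = (\<Sum>i \<in> A. smult c (f i))"
  by (induction A rule: infinite_finite_induct) (simp_all add: smult_add_right)

section \<open>The Riccati equation for \<open>P_pk_dbl\<close>\<close>

lemma P_pk_dbl_nth: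
  "fps_nth P_pk_dbl n = (if n = 0 then 0 else smult [:1 / fact n:] (pk_dbl_poly var_s var_t n))"
  by (simp add: P_pk_dbl_def sum_weight_eq_pk_dbl_poly)

lemma P_pk_dbl_deriv:
  "fps_deriv P_pk_dbl =
    1 + 2 * fps_const var_t * P_pk_dbl + fps_const var_s * (P_pk_dbl * P_pk_dbl)"
proof (rule fps_ext)
  fix n
  let ?a = "pk_dbl_poly var_s var_t" and ?p = "fps_nth P_pk_dbl" and ?e = "fps_nth (1 :: coeff_ring fps)"
  \<comment> \<open>\<open>?p\<close> vanishes at index 0 and \<open>?e\<close> vanishes everywhere
    else, so they detect nonempty and empty factors. For each \<open>k\<close> exactly one of the
    four products survives the case distinction of \<open>split_weight\<close>.\<close>
  have term_eq: "smult [:1 / fact n:] (of_nat (n choose k) *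
      (split_weight var_s var_t k (n - k) * ?a k * ?a (n - k))) =
    var_s * (?p k * ?p (n - k)) + var_t * (?p k * ?e (n - k)) + var_t * (?e k * ?p (n - k)) +
    ?e k * ?e (n - k)" (is "?l = _") if "k \<le> n" for k
  proof -
    have "?l = split_weight var_s var_t k (n - k) *
        (smult [:1 / fact k:] (?a k) * smult [:1 / fact (n - k):] (?a (n - k)))"
      unfolding smult_inverse_fact_mult[OF that] by (simp add: mult_ac)
    then show ?thesis
      by (auto simp: split_weight_def P_pk_dbl_nth one_pCons[symmetric])
  qed
  have "fps_nth (fps_deriv P_pk_dbl) n = smult [:1 / fact n:] (?a (Suc n))"
    using of_nat_mult_smult_inverse_fact[of n "?a (Suc n)"]
    by (simp add: P_pk_dbl_nth del: of_nat_Suc pk_dbl_poly.simps)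
  also have "\<dots> = (\<Sum>k\<le>n. var_s * (?p k * ?p (n - k)) + var_t * (?p k * ?e (n - k)) +
      var_t * (?e k * ?p (n - k)) + ?e k * ?e (n - k))"
    by (simp add: smult_sum_right term_eq)
  \<comment> \<open>The factors 1 stay explicit so that each of the four summands is visibly a
    Cauchy product.\<close>
  also have "\<dots> = fps_nth (fps_const var_s * (P_pk_dbl * P_pk_dbl) +
      fps_const var_t * (P_pk_dbl * 1) + fps_const var_t * (1 * P_pk_dbl) + 1 * 1) n"
    unfolding fps_add_nth fps_mult_left_const_nth fps_mult_nth[of P_pk_dbl] fps_mult_nth[of 1]
    by (simp only: sum.distrib sum_distrib_left atMost_atLeast0)
  also have "fps_const var_s * (P_pk_dbl * P_pk_dbl) +
      fps_const var_t * (P_pk_dbl * 1) + fps_const var_t * (1 * P_pk_dbl) + 1 * 1 =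
    1 + 2 * fps_const var_t * P_pk_dbl + fps_const var_s * (P_pk_dbl * P_pk_dbl)"
    by (simp add: algebra_simps)
  finally show "fps_nth (fps_deriv P_pk_dbl) n = fps_nth (1 + 2 * fps_const var_t * P_pk_dbl +
      fps_const var_s * (P_pk_dbl * P_pk_dbl)) n" .
qed

section \<open>The second-order linear equation for \<open>V\<close>\<close>

lemma V_deriv_nth:
  "fps_nth (fps_deriv V) n =
    (if n = 0 then 0 else smult [:1 / fact n:] (cheb_U var_s var_t (n - 1)))"
  using of_nat_mult_smult_inverse_fact[of n "cheb_U var_s var_t (n - 1)"]
  by (simp add: V_def del: of_nat_Suc)

text \<open>Two derivatives undo the index shift by 2 in \<open>V\<close>, leaving the exponential
  generating function of the Chebyshev polynomials.\<close>

lemma V_deriv2_nth: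
  "fps_nth (fps_deriv (fps_deriv V)) n = smult [:1 / fact n:] (cheb_U var_s var_t n)"
  using of_nat_mult_smult_inverse_fact[of n "cheb_U var_s var_t n"]
  unfolding fps_deriv_nth[of "fps_deriv V"] V_deriv_nth by (simp del: of_nat_Suc)

lemma V_deriv2:
  "fps_deriv (fps_deriv V) = 1 + 2 * fps_const var_t * fps_deriv V - fps_const var_s * V"
proof (rule fps_ext)
  fix n
  have two: "2 * fps_const var_t = fps_const (2 * var_t)"
    by (simp add: numeral_fps_const)
  have "smult [:1 / fact n:] (cheb_U var_s var_t n) =
    fps_nth 1 n + 2 * var_t * fps_nth (fps_deriv V) n - var_s * fps_nth V n"
    unfolding V_deriv_nth
  proof (cases n)
    case (Suc k)
    then show "smult [:1 / fact n:] (cheb_U var_s var_t n) = fps_nth 1 n + 2 * var_t *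
        (if n = 0 then 0 else smult [:1 / fact n:] (cheb_U var_s var_t (n - 1))) - var_s * fps_nth V n"
      \<comment> \<open>The initial values fit as well: at \<open>n = 1\<close> the coefficient of
        \<open>V\<close> is 0, which leaves \<open>2 * var_t\<close> times the initial value 1. At
        \<open>n = 0\<close> the series 1 supplies that initial value.\<close>
      by (cases k) (simp_all add: V_def smult_diff_right)
  qed (simp add: V_def one_pCons[symmetric])
  then show "fps_nth (fps_deriv (fps_deriv V)) n =
    fps_nth (1 + 2 * fps_const var_t * fps_deriv V - fps_const var_s * V) n"
    unfolding two fps_add_nth fps_sub_nth fps_mult_left_const_nth V_deriv2_nth .
qed

section \<open>Uniqueness for linear equations and the conclusion\<close>

lemma fps_linear_ode_zero:
  fixes W :: "'a::{idom, ring_char_0} fps"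
  assumes deriv: "fps_deriv W = G * W" and zero: "fps_nth W 0 = 0"
  shows "W = 0"
proof (rule fps_ext)
  fix n
  show "fps_nth W n = fps_nth 0 n"
  proof (induction n rule: less_induct)
    case (less n)
    show ?case
    proof (cases n)
      case 0
      then show ?thesis by (simp add: zero)
    next
      case (Suc k)
      \<comment> \<open>Coefficient \<open>k\<close> of \<open>G * W\<close> involves only
        coefficients of \<open>W\<close> up to \<open>k\<close>, which vanish by induction. The
        factor \<open>Suc k\<close> can be cancelled in characteristic zero without zero
        divisors.\<close>
      have "of_nat (Suc k) * fps_nth W (Suc k) = fps_nth (G * W) k"
        by (simp flip: deriv)
      also have "\<dots> = 0"
        unfolding fps_mult_nth using less Suc by (intro sum.neutral) auto
      finally show ?thesis by (simp add: Suc del: of_nat_Suc)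
    qed
  qed
qed

theorem theorem3:
  shows "P_pk_dbl = fps_quot (fps_deriv V) (1 - fps_const var_s * V)"
proof -
  define P T S where "P = P_pk_dbl" and "T = fps_const var_t" and "S = fps_const var_s"
  \<comment> \<open>\<open>W\<close> is the difference of the two sides of the claim after clearing
    the denominator.\<close>
  define W where "W = P * (1 - S * V) - fps_deriv V"
  have P': "fps_deriv P = 1 + 2 * T * P + S * (P * P)"
    unfolding P_def T_def S_def by (rule P_pk_dbl_deriv)
  have V'': "fps_deriv (fps_deriv V) = 1 + 2 * T * fps_deriv V - S * V"
    unfolding T_def S_def by (rule V_deriv2)
  have S': "fps_deriv S = 0" by (simp add: S_def)
  \<comment> \<open>In \<open>P' * (1 - S * V) - S * P * V' - V''\<close> the part
    \<open>1 - S * V\<close> from the first product cancels against the same part of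
    \<open>V''\<close>. Everything left carries the factor \<open>2 * T + S * P\<close>.\<close>
  have "fps_deriv W = (2 * T + S * P) * W"
    unfolding W_def by (simp add: P' V'' S' algebra_simps)
  moreover have "fps_nth W 0 = 0"
    by (simp add: W_def P_def P_pk_dbl_nth V_deriv_nth del: fps_deriv_nth)
  ultimately have "W = 0"
    by (rule fps_linear_ode_zero)
  then show ?thesis
    unfolding fps_quot_eq_iff[OF V_denominator_nth_0] by (simp add: W_def P_def S_def)
qed

end
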